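(* Let $\Sigma$ be an alphabet with exactly three letters. Then the set of values $\{\mathbf{Rdio}(\mathbf{a}) : \mathbf{a}=a_0a_1a_2\cdots \text{ an infinite word over } \Sigma\}$ of the refined Diophantine exponent is equal to $[1,\infty]$ (with $\infty$ included).
   Context: An infinite word over an alphabet $\Sigma$ is a sequence $\mathbf{a}=a_0a_1a_2\cdots$ with $a_i\in\Sigma$ for all $i\ge 0$. For integers $0\le r\le s$, $\mathbf{a}[r,s]$ denotes the finite word $a_ra_{r+1}\cdots a_s$. $(\epsilon,\delta)$-closeness: for two finite words $U=u_1\cdots u_L$ and $V=v_1\cdots v_L$ of the same length $L>0$, a real $\epsilon>0$ and an integer $\delta\ge 0$, $U$ and $V$ are $(\epsilon,\delta)$-close if there exist $\delta$ (possibly empty) subintervals $I_1,\dots,I_\delta$ of $\{1,\dots,L\}$ such that $\{1\le i\le L: u_i\ne v_i\}\subseteq \bigcup_{j=1}^{\delta} I_j$ and $\left|\bigcup_{j=1}^{\delta} I_j\right|\le \epsilon L$. Refined Diophantine exponent: for a real $\rho\ge 1$, $\mathbf{a}$ satisfies Condition $( * )_\rho$ if for every $\epsilon>0$ there exist three sequences of integers $(r_n)_{n\ge0}$, $(s_n)_{n\ge0}$, $(t_n)_{n\ge0}$ and an integer $\delta\ge0$ such that: $-1\le r_n<s_n<t_n$ for all $n$; $t_n\ge\rho s_n$ for all $n$; $s_n-r_n\to\infty$ as $n\to\infty$; and for all $n$ large enough, $\mathbf{a}[r_n+1,r_n+t_n-s_n]$ and $\mathbf{a}[s_n+1,t_n]$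 are $(\epsilon,\delta)$-close. The refined Diophantine exponent $\mathbf{Rdio}(\mathbf{a})\in[1,\infty]$ is the supremum of the $\rho$ for which $\mathbf{a}$ satisfies $( * )_\rho$. *)

theory Defs
  imports "HOL-Library.Extended_Real"
begin

(* An infinite word over A is a function a :: nat \<Rightarrow> 'a with range a \<subseteq> A. *)

(* a[i, j].  The indices are integers, since r_n = -1 is allowed below;
   the definition is meant for 0 \<le> i \<le> j only. *)
definition factor :: "(nat \<Rightarrow> 'a) \<Rightarrow> int \<Rightarrow> int \<Rightarrow> 'a list" where
  "factor a i j = map (\<lambda>k. a (nat k)) [i..j]"

definition subinterval :: "nat \<Rightarrow> nat set \<Rightarrow> bool" where
  "subinterval L J \<longleftrightarrow> J \<subseteq> {1..L} \<and> (\<exists>p q. J = {p..q})"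

(* Positions are numbered from 1 as in u_1 ... u_L, whereas list indexing starts at 0. *)
definition mismatches :: "'a list \<Rightarrow> 'a list \<Rightarrow> nat set" where
  "mismatches U V = {i \<in> {1..length U}. U ! (i - 1) \<noteq> V ! (i - 1)}"

definition close_words :: "real \<Rightarrow> nat \<Rightarrow> 'a list \<Rightarrow> 'a list \<Rightarrow> bool" where
  "close_words \<epsilon> \<delta> U V \<longleftrightarrow>
     length U = length V \<and> length U > 0 \<and>
     (\<exists>J :: nat \<Rightarrow> nat set.
        (\<forall>j\<in>{1..\<delta>}. subinterval (length U) (J j)) \<and>
        mismatches U V \<subseteq> (\<Union>j\<in>{1..\<delta>}. J j) \<and>
        real (card (\<Union>j\<in>{1..\<delta>}. J j)) \<le> \<epsilon> * real (length U))"

definition cond_star :: "real \<Rightarrow> (nat \<Rightarrow> 'a) \<Rightarrow> bool" where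
  "cond_star \<rho> a \<longleftrightarrow>
     (\<forall>\<epsilon>>0. \<exists>(r :: nat \<Rightarrow> int) (s :: nat \<Rightarrow> int) (t :: nat \<Rightarrow> int) (\<delta> :: nat).
        (\<forall>n. -1 \<le> r n \<and> r n < s n \<and> s n < t n) \<and>
        (\<forall>n. real_of_int (t n) \<ge> \<rho> * real_of_int (s n)) \<and>
        filterlim (\<lambda>n. s n - r n) at_top sequentially \<and>
        (\<forall>\<^sub>F n in sequentially.
           close_words \<epsilon> \<delta> (factor a (r n + 1) (r n + t n - s n)) (factor a (s n + 1) (t n))))"

definition Rdio :: "(nat \<Rightarrow> 'a) \<Rightarrow> ereal" where
  "Rdio a = Sup {ereal \<rho> | \<rho>. \<rho> \<ge> 1 \<and> cond_star \<rho> a}"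

end

theory Submission
  imports Defs "HOL-Real_Asymp.Real_Asymp"
begin

text \<open>
  A random binary word \<open>w\<close> agrees with none of its shifts on more than a fixed proportion of any
  interval that is long compared with the logarithm of its position; such a word is built
  deterministically by the method of conditional expectations. For finite \<open>\<rho>\<close>, overwrite \<open>w\<close> by
  runs \<open>[N\<^sub>n, M\<^sub>n]\<close> of the third letter, where \<open>M\<^sub>n \<sim> \<rho> N\<^sub>n\<close> and \<open>N\<^sub>n\<^sub>+\<^sub>1 / M\<^sub>n \<rightarrow> \<infinity>\<close>. The runs give
  exponent at least \<open>\<rho>\<close>. Conversely, if \<open>t \<ge> \<rho>' s\<close> with \<open>\<rho>' > \<rho>\<close>, then at scale \<open>t\<close> only one run is
  visible and it cannot cover \<open>(s, t]\<close>, so that a positive proportion of \<open>(s, t]\<close> is an interval on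
  which the pairs \<open>(i, i - d)\<close> either all compare two letters of \<open>w\<close>, or all compare a letter of \<open>w\<close>
  with a letter of the run; both produce many mismatches. The value \<open>\<infinity>\<close> is attained by a constant
  word, and the pigeonhole principle gives the lower bound 1.
\<close>

section \<open>A binary word far from all of its shifts\<close>

definition shift_mismatches :: "(nat \<Rightarrow> 'a) \<Rightarrow> nat \<Rightarrow> nat set \<Rightarrow> nat set" where
  "shift_mismatches w d I = {i \<in> I. w i \<noteq> w (i - d)}"

text \<open>Positions up to \<open>L\<^sup>2\<close> suffice later, where \<open>L\<close> is a
  fixed proportion of the position, and leave only polynomially many pairs \<open>(u, d)\<close> for
  each \<open>L\<close>. As \<open>d \<le> u\<close>, the subtraction \<open>i - d\<close> is never
  truncated.\<close>

definition shift_dissimilar :: "nat \<Rightarrow> (nat \<Rightarrow> 'a) \<Rightarrow> bool" where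
  "shift_dissimilar L0 w \<longleftrightarrow> (\<forall>L\<ge>L0. \<forall>u\<le>L\<^sup>2. \<forall>d\<in>{1..u}. 
     L < 4 * card (shift_mismatches w d {u..<u+L}))"

text \<open>
  With \<open>m\<close> the number of mismatches on an interval of length \<open>L\<close>, the following weights compute the
  conditional expectation of \<open>(5/4)\<^sup>L (1/2)\<^sup>m\<close> when the letters before \<open>n\<close> are those of \<open>w\<close> and the
  others are independent coin tosses. The constant \<open>5/4\<close> is chosen such that \<open>5/4 * 3/4 < 1\<close>, which
  makes the initial weights summable, and \<open>2 \<le> (5/4)\<^sup>4\<close>, so that a final weight below 1 forces
  \<open>m > L/4\<close>.
\<close>

definition cond_weight :: "nat \<Rightarrow> (nat \<Rightarrow> bool) \<Rightarrow> nat \<Rightarrow> nat \<Rightarrow> real" where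
  "cond_weight n w d i = (if i < n then if w i \<noteq> w (i - d) then 1/2 else 1 else 3/4)"

definition interval_weight :: "nat \<Rightarrow> (nat \<Rightarrow> bool) \<Rightarrow> nat \<Rightarrow> nat \<Rightarrow> nat \<Rightarrow> real" where
  "interval_weight n w L u d = (5/4) ^ L * (\<Prod>i\<in>{u..<u+L}. cond_weight n w d i)"

definition length_weight :: "nat \<Rightarrow> (nat \<Rightarrow> bool) \<Rightarrow> nat \<Rightarrow> real" where
  "length_weight n w L = (\<Sum>u\<le>L\<^sup>2. \<Sum>d\<in>{1..u}. interval_weight n w L u d)"

lemma interval_weight_nonneg: "interval_weight n w L u d \<ge> 0"
  unfolding interval_weight_def
  by (intro mult_nonneg_nonneg prod_nonneg) (auto simp: cond_weight_def)

lemma length_weight_nonneg: "length_weight n w L \<ge> 0"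
  unfolding length_weight_def by (intro sum_nonneg interval_weight_nonneg)

lemma interval_weight_cong:
  assumes "\<And>i. i < n \<Longrightarrow> w i = w' i"
  shows "interval_weight n w L u d = interval_weight n w' L u d"
  unfolding interval_weight_def cond_weight_def using assms
  by (intro arg_cong2[where f = "(*)"] refl prod.cong) auto

lemma length_weight_cong:
  assumes "\<And>i. i < n \<Longrightarrow> w i = w' i"
  shows "length_weight n w L = length_weight n w' L"
  unfolding length_weight_def using interval_weight_cong[of n w w'] assms by simp

text \<open>The martingale property: if \<open>n\<close> lies in the interval, its factor 3/4 is the
  mean of the values 1/2 and 1 that the two letters produce. Since \<open>1 \<le> d \<le> u\<close>,
  the partner \<open>n - d\<close> is already decided.\<close>

lemma interval_weight_step:
  assumes "d \<in> {1..u}"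
  shows "interval_weight (Suc n) (w(n := True)) L u d
       + interval_weight (Suc n) (w(n := False)) L u d = 2 * interval_weight n w L u d"
proof -
  let ?I = "{u..<u+L}"
  have old: "cond_weight (Suc n) (w(n := b)) d i = cond_weight n w d i" if "i \<noteq> n" for b i
    using that by (auto simp: cond_weight_def)
  show ?thesis
  proof (cases "n \<in> ?I")
    case True
    have split: "(\<Prod>i\<in>?I. f i) = f n * (\<Prod>i\<in>?I - {n}. f i)" for f :: "nat \<Rightarrow> real"
      using True by (simp add: prod.remove)
    have rest: "(\<Prod>i\<in>?I - {n}. cond_weight (Suc n) (w(n := b)) d i)
              = (\<Prod>i\<in>?I - {n}. cond_weight n w d i)" for b
      by (intro prod.cong) (auto simp: old)
    have "n - d < n" using True assms by auto
    then have "cond_weight (Suc n) (w(n := True)) d n + cond_weight (Suc n) (w(n := False)) d n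
             = 2 * cond_weight n w d n"
      by (auto simp: cond_weight_def)
    then have "C * (cond_weight (Suc n) (w(n := True)) d n * Q)
             + C * (cond_weight (Suc n) (w(n := False)) d n * Q)
             = 2 * (C * (cond_weight n w d n * Q))" for C Q
      by (metis distrib_left distrib_right mult.assoc mult.left_commute)
    then show ?thesis
      unfolding interval_weight_def split rest .
  next
    case False
    then have "(\<Prod>i\<in>?I. cond_weight (Suc n) (w(n := b)) d i) = (\<Prod>i\<in>?I. cond_weight n w d i)" for b
      by (intro prod.cong) (metis old)+
    then show ?thesis by (simp add: interval_weight_def)
  qed
qed

lemma length_weight_step:
  "length_weight (Suc n) (w(n := True)) L + length_weight (Suc n) (w(n := False)) L
   = 2 * length_weight n w L"
  unfolding length_weight_def sum_distrib_left sum.distrib[symmetric]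
  by (intro sum.cong refl interval_weight_step) auto

text \<open>\<open>5/4 * 3/4 = 15/16\<close>, and there are \<open>L\<^sup>2 + 1\<close> choices of
  \<open>u\<close>, each with fewer shifts than that.\<close>

lemma length_weight_0_le: "length_weight 0 w L \<le> (real L ^ 2 + 1) ^ 2 * (15/16) ^ L"
proof -
  have [simp]: "interval_weight 0 w L u d = (15/16) ^ L" for u d
    by (simp add: interval_weight_def cond_weight_def flip: power_mult_distrib)
  have "length_weight 0 w L = (\<Sum>u\<le>L\<^sup>2. real u * (15/16) ^ L)"
    by (simp add: length_weight_def)
  also have "\<dots> \<le> (\<Sum>u\<le>L\<^sup>2. (real L ^ 2 + 1) * (15/16) ^ L)"
  proof (intro sum_mono mult_right_mono)
    fix u assume "u \<in> {..L\<^sup>2}"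
    then have "real u \<le> real (L\<^sup>2)" by (simp only: of_nat_le_iff atMost_iff)
    then show "real u \<le> real L ^ 2 + 1" unfolding of_nat_power by linarith
  qed simp
  finally show ?thesis by (simp add: power2_eq_square algebra_simps)
qed

lemma summable_length_weight_0: "summable (length_weight 0 w)"
proof (rule summable_comparison_test)
  show "\<exists>N. \<forall>n\<ge>N. norm (length_weight 0 w n) \<le> (real n ^ 2 + 1) ^ 2 * (15/16) ^ n"
    using length_weight_0_le length_weight_nonneg by auto
  show "summable (\<lambda>n. (real n ^ 2 + 1) ^ 2 * (15/16) ^ n)"
  proof (rule summable_comparison_test_bigo)
    show "summable (\<lambda>n. norm ((31/32 :: real) ^ n))" by simp
    \<comment> \<open>Any ratio strictly between 15/16 and 1 absorbs the polynomial factor.\<close>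
    show "(\<lambda>n. (real n ^ 2 + 1) ^ 2 * (15/16) ^ n) \<in> O(\<lambda>n. (31/32 :: real) ^ n)" by real_asymp
  qed
qed

text \<open>One step of the derandomisation, for all lengths from \<open>L0\<close> on at once: the
  sums for the two letters average to the old sum, so one of them does not exceed it.\<close>

lemma exists_letter:
  assumes "summable (\<lambda>k. length_weight n w (k + L0))"
  shows "\<exists>b. summable (\<lambda>k. length_weight (Suc n) (w(n := b)) (k + L0)) \<and>
    (\<Sum>k. length_weight (Suc n) (w(n := b)) (k + L0)) \<le> (\<Sum>k. length_weight n w (k + L0))"
proof -
  define F where "F = (\<lambda>b k. length_weight (Suc n) (w(n := b)) (k + L0))"
  have sum2: "F True k + F False k = 2 * length_weight n w (k + L0)" for k
    unfolding F_def by (rule length_weight_step)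
  have nonneg: "F b k \<ge> 0" for b k
    unfolding F_def by (rule length_weight_nonneg)
  have le: "F b k \<le> 2 * length_weight n w (k + L0)" for b k
    using sum2[of k] nonneg[of True k] nonneg[of False k] by (cases b) auto
  have summ: "summable (F b)" for b
    by (rule summable_comparison_test[OF _ summable_mult[OF assms, of 2]])
      (use le nonneg in auto)
  have "(\<Sum>k. F True k) + (\<Sum>k. F False k) = 2 * (\<Sum>k. length_weight n w (k + L0))"
    using suminf_add[OF summ[of True] summ[of False]] suminf_mult[OF assms, of 2]
    by (simp add: sum2)
  then have "(\<Sum>k. F True k) \<le> (\<Sum>k. length_weight n w (k + L0)) \<or>
             (\<Sum>k. F False k) \<le> (\<Sum>k. length_weight n w (k + L0))"
    by linarith
  then obtain b where "(\<Sum>k. F b k) \<le> (\<Sum>k. length_weight n w (k + L0))" by metis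
  with summ[of b] show ?thesis unfolding F_def by (intro exI[of _ b] conjI)
qed

lemma greedy_word:
  assumes "summable (\<lambda>k. length_weight 0 w0 (k + L0))"
  shows "\<exists>w. \<forall>n. summable (\<lambda>k. length_weight n w (k + L0)) \<and>
    (\<Sum>k. length_weight n w (k + L0)) \<le> (\<Sum>k. length_weight 0 w0 (k + L0))"
proof -
  let ?P = "\<lambda>n w. summable (\<lambda>k. length_weight n w (k + L0)) \<and>
    (\<Sum>k. length_weight n w (k + L0)) \<le> (\<Sum>k. length_weight 0 w0 (k + L0))"
  have "\<exists>f. \<forall>n. ?P n (f n) \<and> (\<exists>b. f (Suc n) = (f n)(n := b))"
  proof (rule dependent_nat_choice)
    show "\<exists>w. ?P 0 w" using assms by blast
    fix w n assume "?P n w"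
    then obtain b where "?P (Suc n) (w(n := b))" 
      using exists_letter[of n w L0] by (meson order_trans)
    then show "\<exists>w'. ?P (Suc n) w' \<and> (\<exists>b. w' = w(n := b))" by blast
  qed
  then obtain f where f: "\<And>n. ?P n (f n)" and step: "\<And>n. \<exists>b. f (Suc n) = (f n)(n := b)"
    by blast
  \<comment> \<open>The letter at \<open>i\<close> is chosen in step \<open>i\<close> and kept by
    all later ones, so this diagonal agrees with \<open>f n\<close> below \<open>n\<close>, and the
    weights at stage \<open>n\<close> look no further.\<close>
  define w where "w = (\<lambda>i. f (Suc i) i)"
  have "f n i = w i" if "i < n" for i n
    using that
  proof (induction n)
    case (Suc n)
    show ?case
    proof (cases "i = n")
      case False
      then show ?thesis using Suc step[of n] by auto
    qed (simp add: w_def)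
  qed simp
  then have "length_weight n w L = length_weight n (f n) L" for n L
    by (intro length_weight_cong) simp
  then show ?thesis using f by (intro exI[of _ w]) simp
qed

text \<open>Start with a tail of total weight below 1. The greedy choices keep it there, so every
  single weight stays below 1; once its interval is fully decided, this forces many
  mismatches.\<close>

lemma exists_shift_dissimilar: "\<exists>(w :: nat \<Rightarrow> bool) L0. shift_dissimilar L0 w"
proof -
  \<comment> \<open>The seed is arbitrary: at stage 0 every factor is 3/4.\<close>
  define w0 :: "nat \<Rightarrow> bool" where "w0 = (\<lambda>_. False)"
  obtain L0 where L0: "norm (\<Sum>k. length_weight 0 w0 (k + L0)) < 1"
    using suminf_exist_split[OF zero_less_one summable_length_weight_0[of w0]] by blast
  have "summable (\<lambda>k. length_weight 0 w0 (k + L0))"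
    using summable_length_weight_0 summable_ignore_initial_segment by blast
  from greedy_word[OF this] obtain w where
    w: "\<And>n. summable (\<lambda>k. length_weight n w (k + L0))"
       "\<And>n. (\<Sum>k. length_weight n w (k + L0)) \<le> (\<Sum>k. length_weight 0 w0 (k + L0))"
    by blast
  have lw: "length_weight n w L < 1" if "L \<ge> L0" for n L
  proof -
    have "length_weight n w L = (\<Sum>k\<in>{L - L0}. length_weight n w (k + L0))" using that by simp
    also have "\<dots> \<le> (\<Sum>k. length_weight n w (k + L0))"
      by (intro sum_le_suminf w(1)) (auto intro: length_weight_nonneg)
    finally show ?thesis using w(2)[of n] L0 by simp
  qed
  have "L < 4 * card (shift_mismatches w d {u..<u+L})" if "L \<ge> L0" "u \<le> L\<^sup>2" "d \<in> {1..u}" for L u d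
  proof -
    \<comment> \<open>At stage \<open>u + L\<close> all letters of the interval and all their
      partners are decided.\<close>
    let ?n = "u + L" and ?m = "card (shift_mismatches w d {u..<u+L})"
    have "interval_weight ?n w L u d \<le> (\<Sum>d\<in>{1..u}. interval_weight ?n w L u d)"
      by (intro member_le_sum that interval_weight_nonneg) auto
    also have "\<dots> \<le> length_weight ?n w L"
      unfolding length_weight_def
      by (rule member_le_sum[where f = "\<lambda>u. \<Sum>d\<in>{1..u}. interval_weight ?n w L u d"])
        (use that in \<open>auto intro!: sum_nonneg interval_weight_nonneg\<close>)
    also have "\<dots> < 1" using lw that by blast
    finally have "interval_weight ?n w L u d < 1" .
    moreover have "(\<Prod>i\<in>{u..<u+L}. cond_weight ?n w d i) = (1/2) ^ ?m"
    proof -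
      have "(\<Prod>i\<in>{u..<u+L}. cond_weight ?n w d i)
          = (\<Prod>i\<in>{u..<u+L}. if w i \<noteq> w (i - d) then 1/2 else 1)"
        by (intro prod.cong) (auto simp: cond_weight_def)
      also have "\<dots> = (\<Prod>i\<in>shift_mismatches w d {u..<u+L}. 1/2)"
        unfolding shift_mismatches_def by (rule prod.inter_filter[symmetric]) simp
      finally show ?thesis by simp
    qed
    ultimately have "(5/4) ^ L / (2 :: real) ^ ?m < 1"
      by (simp only: interval_weight_def power_one_over) simp
    then have "(5/4) ^ L < (2 :: real) ^ ?m" by (subst (asm) divide_less_eq_1_pos) simp_all
    also have "\<dots> \<le> ((5/4) ^ 4) ^ ?m"
      by (intro power_mono) (auto simp: field_simps)
    finally have "(5/4 :: real) ^ L < (5/4) ^ (4 * ?m)" by (simp add: power_mult)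
    then show ?thesis by (subst (asm) power_strict_increasing_iff) auto
  qed
  then have "shift_dissimilar L0 w" by (simp add: shift_dissimilar_def)
  then show ?thesis by blast
qed

section \<open>Mismatches in the presence of a single run\<close>

lemma shift_mismatches_mono: "I \<subseteq> J \<Longrightarrow> shift_mismatches w d I \<subseteq> shift_mismatches w d J"
  by (auto simp: shift_mismatches_def)

lemma finite_shift_mismatches: "finite I \<Longrightarrow> finite (shift_mismatches w d I)"
  by (simp add: shift_mismatches_def)

lemma halve_interval:
  fixes u L p :: nat
  obtains u' L' where "u \<le> u'" "u' + L' \<le> u + L" "L \<le> 2 * L'"
    "(\<forall>i\<in>{u'..<u'+L'}. i < p) \<or> (\<forall>i\<in>{u'..<u'+L'}. p \<le> i)"
proof (cases "p \<le> u + L div 2")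
  case True
  then show ?thesis by (intro that[of "u + L div 2" "L - L div 2"]) auto
next
  case False
  then show ?thesis by (intro that[of u "L - L div 2"]) auto
qed

text \<open>Two halvings, at \<open>N\<close> and at \<open>Suc M\<close>, cost the factor
  4.\<close>

lemma constant_piece:
  fixes u L N M :: nat
  obtains u' L' where "u \<le> u'" "u' + L' \<le> u + L" "L \<le> 4 * L'"
    "(\<forall>i\<in>{u'..<u'+L'}. i \<in> {N..M}) \<or> (\<forall>i\<in>{u'..<u'+L'}. i \<notin> {N..M})"
proof -
  obtain u1 L1 where 1: "u \<le> u1" "u1 + L1 \<le> u + L" "L \<le> 2 * L1"
    "(\<forall>i\<in>{u1..<u1+L1}. i < N) \<or> (\<forall>i\<in>{u1..<u1+L1}. N \<le> i)"
    by (rule halve_interval)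
  obtain u2 L2 where 2: "u1 \<le> u2" "u2 + L2 \<le> u1 + L1" "L1 \<le> 2 * L2"
    "(\<forall>i\<in>{u2..<u2+L2}. i < Suc M) \<or> (\<forall>i\<in>{u2..<u2+L2}. Suc M \<le> i)"
    by (rule halve_interval)
  have sub: "i \<in> {u1..<u1+L1}" if "i \<in> {u2..<u2+L2}" for i using that 2 by auto
  have "(\<forall>i\<in>{u2..<u2+L2}. i \<in> {N..M}) \<or> (\<forall>i\<in>{u2..<u2+L2}. i \<notin> {N..M})"
    using 1(4)
  proof
    assume "\<forall>i\<in>{u1..<u1+L1}. i < N"
    then have "\<forall>i\<in>{u2..<u2+L2}. i \<notin> {N..M}" using sub by (metis atLeastAtMost_iff leD)
    then show ?thesis ..
  next
    assume N: "\<forall>i\<in>{u1..<u1+L1}. N \<le> i"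
    show ?thesis
      using 2(4)
    proof
      assume "\<forall>i\<in>{u2..<u2+L2}. i < Suc M"
      then have "\<forall>i\<in>{u2..<u2+L2}. i \<in> {N..M}"
        using sub N by (metis atLeastAtMost_iff less_Suc_eq_le)
      then show ?thesis ..
    next
      assume "\<forall>i\<in>{u2..<u2+L2}. Suc M \<le> i"
      then have "\<forall>i\<in>{u2..<u2+L2}. i \<notin> {N..M}" by (metis atLeastAtMost_iff Suc_le_eq leD)
      then show ?thesis ..
    qed
  qed
  with 1 2 show ?thesis by (intro that[of u2 L2]) linarith+
qed

text \<open>A second use of \<open>constant_piece\<close>, for the run translated by
  \<open>d\<close>, raises the cost to 16. With \<open>d \<le> u\<close>, subtracting
  \<open>d\<close> really undoes the translation.\<close>

lemma constant_piece_shifted: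
  fixes u L N M d :: nat
  assumes "d \<le> u"
  obtains u' L' where "u \<le> u'" "u' + L' \<le> u + L" "L \<le> 16 * L'"
    "(\<forall>i\<in>{u'..<u'+L'}. i \<in> {N..M}) \<or> (\<forall>i\<in>{u'..<u'+L'}. i \<notin> {N..M})"
    "(\<forall>i\<in>{u'..<u'+L'}. i - d \<in> {N..M}) \<or> (\<forall>i\<in>{u'..<u'+L'}. i - d \<notin> {N..M})"
proof -
  obtain u1 L1 where 1: "u \<le> u1" "u1 + L1 \<le> u + L" "L \<le> 4 * L1"
    "(\<forall>i\<in>{u1..<u1+L1}. i \<in> {N..M}) \<or> (\<forall>i\<in>{u1..<u1+L1}. i \<notin> {N..M})"
    by (rule constant_piece)
  obtain u2 L2 where 2: "u1 \<le> u2" "u2 + L2 \<le> u1 + L1" "L1 \<le> 4 * L2"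
    "(\<forall>i\<in>{u2..<u2+L2}. i \<in> {N+d..M+d}) \<or> (\<forall>i\<in>{u2..<u2+L2}. i \<notin> {N+d..M+d})"
    by (rule constant_piece)
  have sub: "{u2..<u2+L2} \<subseteq> {u1..<u1+L1}" using 2 by auto
  have "i - d \<in> {N..M} \<longleftrightarrow> i \<in> {N+d..M+d}" if "i \<in> {u2..<u2+L2}" for i
    using that assms 1 2 by auto
  with 2(4) have shifted:
    "(\<forall>i\<in>{u2..<u2+L2}. i - d \<in> {N..M}) \<or> (\<forall>i\<in>{u2..<u2+L2}. i - d \<notin> {N..M})"
    by simp
  have "(\<forall>i\<in>{u2..<u2+L2}. i \<in> {N..M}) \<or> (\<forall>i\<in>{u2..<u2+L2}. i \<notin> {N..M})"
    using 1(4) sub by (meson subsetD)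
  with shifted show ?thesis using 1 2 by (intro that[of u2 L2]) linarith+
qed

text \<open>On a piece of length at least \<open>L / 16\<close> all pairs \<open>(i, i - d)\<close>
  are of one type. Either both letters come from \<open>w\<close>, and dissimilarity makes over a
  quarter of them mismatch, or exactly one is \<open>z\<close>, and all mismatch. Hence 64 = 16 *
  4.\<close>

lemma many_mismatches_on_interval:
  fixes a :: "nat \<Rightarrow> 'a" and N M k t d u L :: nat
  assumes w: "shift_dissimilar L0 w"
    and "distinct [x, y, z]"
    and a: "\<And>i. i \<in> {k..t} \<Longrightarrow> a i = (if i \<in> {N..M} then z else if w i then x else y)"
    and d: "1 \<le> d" "d + k \<le> u" and t: "u + L \<le> t + 1"
    and both: "\<And>i. i \<in> {u..<u+L} \<Longrightarrow> \<not> (i \<in> {N..M} \<and> i - d \<in> {N..M})"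
    and L: "16 * L0 \<le> L" "256 * (t + 1) \<le> L\<^sup>2"
  shows "L \<le> 64 * card (shift_mismatches a d {u..<u+L})"
proof -
  obtain u' L' where 1: "u \<le> u'" "u' + L' \<le> u + L" "L \<le> 16 * L'"
    "(\<forall>i\<in>{u'..<u'+L'}. i \<in> {N..M}) \<or> (\<forall>i\<in>{u'..<u'+L'}. i \<notin> {N..M})"
    "(\<forall>i\<in>{u'..<u'+L'}. i - d \<in> {N..M}) \<or> (\<forall>i\<in>{u'..<u'+L'}. i - d \<notin> {N..M})"
    using d by (elim constant_piece_shifted[of d u L N M, rotated]) auto
  have sub: "{u'..<u'+L'} \<subseteq> {u..<u+L}" using 1 by auto
  have inI: "i \<in> {k..t}" "i - d \<in> {k..t}" if "i \<in> {u'..<u'+L'}" for i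
    using that 1 d t by auto
  have "L' \<le> 4 * card (shift_mismatches a d {u'..<u'+L'})"
  proof (cases "\<forall>i\<in>{u'..<u'+L'}. i \<notin> {N..M} \<and> i - d \<notin> {N..M}")
    case True
    have "a i \<noteq> a (i - d) \<longleftrightarrow> w i \<noteq> w (i - d)" if "i \<in> {u'..<u'+L'}" for i
    proof -
      have "i \<notin> {N..M}" "i - d \<notin> {N..M}" using True that by blast+
      then show ?thesis
        using assms(2) a[OF inI(1)[OF that]] a[OF inI(2)[OF that]] by (auto split: if_splits)
    qed
    then have eq: "shift_mismatches a d {u'..<u'+L'} = shift_mismatches w d {u'..<u'+L'}"
      unfolding shift_mismatches_def by blast
    \<comment> \<open>\<open>256 = 16\<^sup>2\<close>, so the piece still meets the bound on
      positions in \<open>shift_dissimilar\<close>.\<close>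
    have "L\<^sup>2 \<le> (16 * L')\<^sup>2" using 1 by (intro power_mono) auto
    then have "256 * (t + 1) \<le> 256 * L'\<^sup>2" using L by (simp add: power_mult_distrib)
    then have "t + 1 \<le> L'\<^sup>2" by simp
    moreover have "u' \<le> t + 1" using 1(1,2) t by linarith
    ultimately have "u' \<le> L'\<^sup>2" by (rule order_trans[rotated])
    then have "L' < 4 * card (shift_mismatches w d {u'..<u'+L'})"
      using w 1 d L by (auto simp: shift_dissimilar_def)
    then show ?thesis using eq by simp
  next
    case False
    have "a i \<noteq> a (i - d)" if "i \<in> {u'..<u'+L'}" for i
    proof -
      have "(i \<in> {N..M}) \<noteq> (i - d \<in> {N..M})"
        using False 1(4,5) both sub that by blast
      then show ?thesis
        using assms(2) a[OF inI(1)[OF that]] a[OF inI(2)[OF that]] by (auto split: if_splits)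
    qed
    then have "shift_mismatches a d {u'..<u'+L'} = {u'..<u'+L'}"
      unfolding shift_mismatches_def by blast
    then show ?thesis by simp
  qed
  moreover have "card (shift_mismatches a d {u'..<u'+L'}) \<le> card (shift_mismatches a d {u..<u+L})"
    by (intro card_mono shift_mismatches_mono finite_shift_mismatches sub) simp
  ultimately show ?thesis using 1 by linarith
qed

text \<open>Here \<open>s \<le> t / \<rho>'\<close>, whereas a run reaching almost up to
  \<open>t\<close> cannot start much before \<open>t / \<rho>\<close>. The gap leaves an interval of
  length at least \<open>k\<close> with no pair inside the run. The number \<open>k\<close>, of
  order \<open>\<kappa> * t\<close>, is also the point from which one run describes the
  word.\<close>

lemma many_mismatches_one_run:
  fixes a :: "nat \<Rightarrow> 'a" and \<rho> \<rho>' \<kappa> :: real and N M s t k d :: nat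
  assumes w: "shift_dissimilar L0 w"
    and xyz: "distinct [x, y, z]"
    and \<rho>: "1 \<le> \<rho>" "\<rho> < \<rho>'" and \<kappa>: "0 < \<kappa>" "1/\<rho>' + 4 * \<kappa> \<le> (1 - 2 * \<kappa>) / (\<rho> + \<kappa>)"
    and k: "\<kappa> * t \<le> k" "k \<le> 2 * \<kappa> * t"
    and a: "\<And>i. i \<in> {k..t} \<Longrightarrow> a i = (if i \<in> {N..M} then z else if w i then x else y)"
    and M: "M \<le> (\<rho> + \<kappa>) * N"
    and st: "\<rho>' * s \<le> t" and d: "1 \<le> d" "d \<le> s + 1"
    and L: "16 * L0 \<le> k" "256 * (t + 1) \<le> k\<^sup>2"
  shows "k \<le> 64 * card (shift_mismatches a d {s+1..t})"
proof -
  have s: "s \<le> t / \<rho>'" using st \<rho> by (simp add: field_simps)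
  \<comment> \<open>The term \<open>4 * \<kappa>\<close> pays for \<open>2 * k\<close>: one
    \<open>k\<close> to skip after \<open>s\<close>, one for the interval itself.\<close>
  have "real s + 2 * k \<le> t * (1/\<rho>' + 4 * \<kappa>)" using s k by (simp add: algebra_simps)
  also have "\<dots> \<le> t * ((1 - 2 * \<kappa>) / (\<rho> + \<kappa>))"
    using \<kappa> by (intro mult_left_mono) auto
  finally have s2k: "real s + 2 * k \<le> t * (1 - 2 * \<kappa>) / (\<rho> + \<kappa>)" by simp
  have "1/\<rho>' > 0" using \<rho> by simp
  then have "(1 - 2 * \<kappa>) / (\<rho> + \<kappa>) > 0" using \<kappa> by linarith
  then have pos: "1 - 2 * \<kappa> > 0" using \<rho> \<kappa> by (simp add: zero_less_divide_iff)
  have "(1 - 2 * \<kappa>) / (\<rho> + \<kappa>) \<le> 1 / 1"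
    using \<rho> \<kappa> pos by (intro frac_le) auto
  then have "t * ((1 - 2 * \<kappa>) / (\<rho> + \<kappa>)) \<le> real t * 1" by (intro mult_left_mono) auto
  then have "real s + 2 * k \<le> t" using s2k by simp
  then have st2: "s + 2 * k \<le> t" by linarith
  \<comment> \<open>For \<open>i > s + k\<close> both \<open>i\<close> and \<open>i - d\<close> are at least \<open>k\<close>. The pairs lying entirely in the run have
      \<open>N + d \<le> i \<le> M\<close>. If the run ends well before \<open>t\<close>, use what follows it; otherwise
      it must start late, and \<open>i < N + d\<close> leaves enough room.\<close>
  obtain u L where uL: "s + 1 + k \<le> u" "u + L \<le> t + 1" "k \<le> L"
    "\<And>i. i \<in> {u..<u+L} \<Longrightarrow> \<not> (i \<in> {N..M} \<and> i - d \<in> {N..M})"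
  proof (cases "M + k < t")
    case True
    show ?thesis
    proof (rule that[of "max (s+1+k) (M+1)" "t + 1 - max (s+1+k) (M+1)"])
      show "max (s+1+k) (M+1) + (t + 1 - max (s+1+k) (M+1)) \<le> t + 1" using True st2 by auto
      show "k \<le> t + 1 - max (s+1+k) (M+1)" using True st2 by auto
    qed auto
  next
    case False
    have "t * (1 - 2 * \<kappa>) \<le> real t - k" using k by (simp add: algebra_simps)
    also have "\<dots> \<le> M" using False by linarith
    also have "\<dots> \<le> (\<rho> + \<kappa>) * N" by (rule M)
    finally have "t * (1 - 2 * \<kappa>) / (\<rho> + \<kappa>) \<le> N" using \<rho> \<kappa> by (simp add: field_simps)
    then have N: "s + 2 * k \<le> N" using s2k by linarith
    show ?thesis
    proof (rule that[of "s + 1 + k" "min (N + d) (t + 1) - (s + 1 + k)"])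
      show "s + 1 + k + (min (N + d) (t + 1) - (s + 1 + k)) \<le> t + 1" using st2 by auto
      show "k \<le> min (N + d) (t + 1) - (s + 1 + k)" using st2 N d by auto
      show "\<not> (i \<in> {N..M} \<and> i - d \<in> {N..M})"
        if "i \<in> {s + 1 + k..<s + 1 + k + (min (N + d) (t + 1) - (s + 1 + k))}" for i
      proof -
        have "i < N + d" "d \<le> i" using that d by auto
        then show ?thesis by auto
      qed
    qed simp
  qed
  have "L \<le> 64 * card (shift_mismatches a d {u..<u+L})"
  proof (rule many_mismatches_on_interval[where k = k and t = t and N = N and M = M, OF w xyz])
    show "a i = (if i \<in> {N..M} then z else if w i then x else y)" if "i \<in> {k..t}" for i
      using that by (rule a)
    show "\<not> (i \<in> {N..M} \<and> i - d \<in> {N..M})" if "i \<in> {u..<u+L}" for i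
      using that by (rule uL(4))
    show "256 * (t + 1) \<le> L\<^sup>2" using power_mono[OF uL(3), of 2] L(2) by linarith
  qed (use uL(1-3) d L in auto)
  also have "card (shift_mismatches a d {u..<u+L}) \<le> card (shift_mismatches a d {s+1..t})"
    using uL by (intro card_mono shift_mismatches_mono finite_shift_mismatches) auto
  finally show ?thesis using uL by simp
qed

section \<open>The binary word overwritten by sparse runs\<close>

text \<open>Consecutive starts have ratio \<open>2 ^ (2 * n + 1)\<close>, so any fixed factor
  eventually fits between two runs.\<close>

definition run_start :: "nat \<Rightarrow> nat" where
  "run_start n = 2 ^ (n * n)"

text \<open>The additional \<open>n\<close> lets \<open>s\<^sub>n - r\<^sub>n\<close> tend to infinity inside the runs, also for \<open>\<rho> = 1\<close>.\<close>

definition run_end :: "real \<Rightarrow> nat \<Rightarrow> nat" where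
  "run_end \<rho> n = nat \<lceil>\<rho> * (run_start n + n)\<rceil> + 1"

definition word_with_runs :: "'a \<Rightarrow> 'a \<Rightarrow> 'a \<Rightarrow> (nat \<Rightarrow> bool) \<Rightarrow> real \<Rightarrow> nat \<Rightarrow> 'a" where
  "word_with_runs x y z w \<rho> i =
     (if \<exists>n. i \<in> {run_start n..run_end \<rho> n} then z else if w i then x else y)"

lemma run_start_mono: "m \<le> n \<Longrightarrow> run_start m \<le> run_start n"
  unfolding run_start_def by (intro power_increasing mult_le_mono) auto

lemma run_end_bounds:
  fixes \<rho> :: real
  assumes "\<rho> \<ge> 1"
  shows "\<rho> * (run_start n + n) + 1 \<le> run_end \<rho> n" "run_end \<rho> n \<le> \<rho> * (run_start n + n) + 2"
proof -
  have "\<rho> * (run_start n + n) \<ge> 0" using assms by simp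
  then show "\<rho> * (run_start n + n) + 1 \<le> run_end \<rho> n" "run_end \<rho> n \<le> \<rho> * (run_start n + n) + 2"
    unfolding run_end_def by linarith+
qed

lemma eventually_run_end_le:
  fixes \<rho> \<kappa> :: real
  assumes "\<rho> \<ge> 1" "\<kappa> > 0"
  shows "\<forall>\<^sub>F n in sequentially. run_end \<rho> n \<le> (\<rho> + \<kappa>) * run_start n"
proof -
  have "\<forall>\<^sub>F n in sequentially. \<rho> * (2 ^ (n * n) + real n) + 2 \<le> (\<rho> + \<kappa>) * 2 ^ (n * n)"
    using assms by real_asymp
  then show ?thesis
  proof eventually_elim
    case (elim n)
    then have "\<rho> * (run_start n + n) + 2 \<le> (\<rho> + \<kappa>) * run_start n" by (simp add: run_start_def)
    with run_end_bounds(2)[OF assms(1), of n] show ?case by linarith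
  qed
qed

lemma eventually_run_end_less:
  fixes \<rho> C :: real
  assumes "\<rho> \<ge> 1" "C > 0"
  shows "\<forall>\<^sub>F n in sequentially. C * run_end \<rho> n < run_start (Suc n)"
proof -
  have "\<forall>\<^sub>F n in sequentially. C * (\<rho> + 1) * 2 ^ (n * n) < 2 ^ (Suc n * Suc n)"
    using assms by real_asymp
  with eventually_run_end_le[OF assms(1) zero_less_one] show ?thesis
  proof eventually_elim
    case (elim n)
    have "C * run_end \<rho> n \<le> C * ((\<rho> + 1) * run_start n)"
      using elim(1) assms by (intro mult_left_mono) auto
    also have "\<dots> < run_start (Suc n)" 
      using elim(2) by (simp add: run_start_def mult.assoc)
    finally show ?case .
  qed
qed

text \<open>Consecutive runs are eventually separated by a factor above \<open>1/\<kappa>\<close>,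
  while \<open>t \<le> k/\<kappa>\<close>. So of the runs not finished before \<open>k\<close>, only
  the first can begin by \<open>t\<close>.\<close>

lemma one_run_visible:
  fixes \<rho> \<kappa> :: real
  assumes \<rho>: "\<rho> \<ge> 1" and \<kappa>: "\<kappa> > 0"
  obtains T where "\<And>t k. T \<le> k \<Longrightarrow> \<kappa> * real t \<le> real k \<Longrightarrow>
    \<exists>N M. real M \<le> (\<rho> + \<kappa>) * real N \<and>
      (\<forall>i\<in>{k..t}. (\<exists>n. i \<in> {run_start n..run_end \<rho> n}) \<longleftrightarrow> i \<in> {N..M})"
proof -
  have "\<forall>\<^sub>F n in sequentially. run_end \<rho> n \<le> (\<rho> + \<kappa>) * run_start n \<and>
      1/\<kappa> * run_end \<rho> n < run_start (Suc n)"
    using assms by (intro eventually_conj eventually_run_end_le eventually_run_end_less) auto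
  then obtain n1 where n1: "\<And>n. n \<ge> n1 \<Longrightarrow> run_end \<rho> n \<le> (\<rho> + \<kappa>) * run_start n"
     "\<And>n. n \<ge> n1 \<Longrightarrow> 1/\<kappa> * run_end \<rho> n < run_start (Suc n)"
    unfolding eventually_sequentially by blast
  \<comment> \<open>Lies beyond the first \<open>n1\<close> runs, so that the run found below has an
    index for which both estimates hold.\<close>
  define T where "T = Suc (\<Sum>m<n1. run_end \<rho> m)"
  show ?thesis
  proof (rule that[of T])
    fix t k assume k: "T \<le> k" "\<kappa> * real t \<le> real k"
    have "\<exists>n. k \<le> run_end \<rho> n"
    proof
      have "k < run_start k"
        unfolding run_start_def by (metis less_exp le_square less_le_trans power_increasing one_le_numeral)
      also have "run_start k + k \<le> \<rho> * (run_start k + k)" using \<rho> by (simp add: mult_le_cancel_right1)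
      then have "run_start k \<le> run_end \<rho> k" using run_end_bounds(1)[OF \<rho>, of k] by linarith
      finally show "k \<le> run_end \<rho> k" by simp
    qed
    then have "k \<le> run_end \<rho> (LEAST n. k \<le> run_end \<rho> n)" by (rule LeastI_ex)
    moreover have "run_end \<rho> m < k" if "m < (LEAST n. k \<le> run_end \<rho> n)" for m
      using not_less_Least[OF that] by simp
    ultimately obtain n where n: "k \<le> run_end \<rho> n" "\<And>m. m < n \<Longrightarrow> run_end \<rho> m < k" ..
    have "run_end \<rho> m < T" if "m < n1" for m
      using that member_le_sum[of m "{..<n1}" "run_end \<rho>"] by (simp add: T_def)
    then have "n \<ge> n1" using n(1) k(1) by (meson le_trans not_le)
    have "real t \<le> 1/\<kappa> * run_end \<rho> n" using k(2) n(1) \<kappa> by (simp add: field_simps)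
    also have "\<dots> < run_start (Suc n)" using n1 \<open>n \<ge> n1\<close> by blast
    finally have t: "t < run_start (Suc n)" by simp
    have "m = n" if "i \<in> {k..t}" "i \<in> {run_start m..run_end \<rho> m}" for m i
    proof (rule ccontr)
      assume "m \<noteq> n"
      then consider "m < n" | "Suc n \<le> m" by linarith
      then show False using that n(2)[of m] t run_start_mono[of "Suc n" m] by cases auto
    qed
    then show "\<exists>N M. real M \<le> (\<rho> + \<kappa>) * real N \<and>
      (\<forall>i\<in>{k..t}. (\<exists>n. i \<in> {run_start n..run_end \<rho> n}) \<longleftrightarrow> i \<in> {N..M})"
      using n1(1)[OF \<open>n \<ge> n1\<close>] by blast
  qed
qed

text \<open>For small \<kappa> the inequality required by \<open>many_mismatches_one_run\<close> is
  a perturbation of \<open>1/\<rho>' < 1/\<rho>\<close>.\<close>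

lemma word_with_runs_dissimilar:
  fixes \<rho> \<rho>' :: real
  assumes w: "shift_dissimilar L0 w"
    and xyz: "distinct [x, y, z]" and \<rho>: "1 \<le> \<rho>" "\<rho> < \<rho>'"
  shows "\<exists>\<epsilon>>0. \<exists>T :: nat. \<forall>t\<ge>T. \<forall>s d :: nat. \<rho>' * s \<le> t \<longrightarrow> d \<in> {1..s+1} \<longrightarrow>
    \<epsilon> * real t < card (shift_mismatches (word_with_runs x y z w \<rho>) d {s+1..t})"
proof -
  have "((\<lambda>\<kappa>. (1 - 2 * \<kappa>) / (\<rho> + \<kappa>) - 4 * \<kappa>) \<longlongrightarrow> (1 - 2 * 0) / (\<rho> + 0) - 4 * 0) (at_right 0)"
    using \<rho> by (intro tendsto_intros) auto
  moreover have "1 / \<rho>' < (1 - 2 * 0) / (\<rho> + 0) - 4 * 0" using \<rho> by (simp add: frac_less2)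
  ultimately have "\<forall>\<^sub>F \<kappa> in at_right 0. 1 / \<rho>' < (1 - 2 * \<kappa>) / (\<rho> + \<kappa>) - 4 * \<kappa>"
    by (rule order_tendstoD(1))
  then have "\<forall>\<^sub>F \<kappa> in at_right 0. 0 < \<kappa> \<and> 1 / \<rho>' < (1 - 2 * \<kappa>) / (\<rho> + \<kappa>) - 4 * \<kappa>"
    using eventually_at_right_less[of "0::real"] by eventually_elim simp
  then obtain \<kappa> where \<kappa>: "0 < \<kappa>" "1 / \<rho>' < (1 - 2 * \<kappa>) / (\<rho> + \<kappa>) - 4 * \<kappa>"
    using eventually_happens'[OF trivial_limit_at_right_real] by blast
  obtain T where T: "\<And>t k. T \<le> k \<Longrightarrow> \<kappa> * real t \<le> real k \<Longrightarrow>
    \<exists>N M. real M \<le> (\<rho> + \<kappa>) * real N \<and>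
      (\<forall>i\<in>{k..t}. (\<exists>n. i \<in> {run_start n..run_end \<rho> n}) \<longleftrightarrow> i \<in> {N..M})"
    using one_run_visible[OF \<rho>(1) \<kappa>(1)] by blast
  have "\<forall>\<^sub>F t :: nat in sequentially. real T \<le> \<kappa> * t \<and> real (16 * L0) \<le> \<kappa> * t \<and> 1 \<le> \<kappa> * t \<and>
      256 * (real t + 1) \<le> (\<kappa> * t)\<^sup>2"
    using \<kappa>(1) by (intro eventually_conj; real_asymp)
  then obtain T' where T': "\<And>t :: nat. T' \<le> t \<Longrightarrow> real T \<le> \<kappa> * t \<and> real (16 * L0) \<le> \<kappa> * t \<and>
      1 \<le> \<kappa> * t \<and> 256 * (real t + 1) \<le> (\<kappa> * t)\<^sup>2"
    unfolding eventually_sequentially by blast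
  \<comment> \<open>Half of \<open>\<kappa> / 64\<close>, to obtain a strict inequality.\<close>
  show ?thesis
  proof (intro exI[of _ "\<kappa> / 128"] exI[of _ T'] conjI allI impI)
    show "\<kappa> / 128 > 0" using \<kappa> by simp
    fix s t d :: nat
    assume t: "T' \<le> t" and st: "\<rho>' * s \<le> t" and "d \<in> {1..s+1}"
    then have d: "1 \<le> d" "d \<le> s + 1" by auto
    let ?a = "word_with_runs x y z w \<rho>"
    define k where "k = nat \<lceil>\<kappa> * t\<rceil>"
    note large = T'[OF t]
    \<comment> \<open>Rounding up at most doubles \<open>\<kappa> * t\<close>, because it is at
      least 1.\<close>
    have k: "\<kappa> * t \<le> k" "k \<le> 2 * \<kappa> * t" using large unfolding k_def by linarith+
    have "T \<le> k" "16 * L0 \<le> k" using large k(1) by linarith+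
    have "(\<kappa> * t)\<^sup>2 \<le> (real k)\<^sup>2" using k(1) \<kappa>(1) by (intro power_mono) auto
    with large have "256 * (real t + 1) \<le> (real k)\<^sup>2" by (meson order_trans)
    then have "real (256 * (t + 1)) \<le> real (k\<^sup>2)" by simp
    then have ksq: "256 * (t + 1) \<le> k\<^sup>2" by (simp only: of_nat_le_iff)
    obtain N M where NM: "real M \<le> (\<rho> + \<kappa>) * real N"
      "\<forall>i\<in>{k..t}. (\<exists>n. i \<in> {run_start n..run_end \<rho> n}) \<longleftrightarrow> i \<in> {N..M}"
      using T[OF \<open>T \<le> k\<close> k(1)] by blast
    have "k \<le> 64 * card (shift_mismatches ?a d {s+1..t})"
    proof (rule many_mismatches_one_run[OF w xyz \<rho> \<kappa>(1) _ k _ NM(1) st d \<open>16 * L0 \<le> k\<close> ksq])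
      show "1 / \<rho>' + 4 * \<kappa> \<le> (1 - 2 * \<kappa>) / (\<rho> + \<kappa>)" using \<kappa>(2) by linarith
      show "?a i = (if i \<in> {N..M} then z else if w i then x else y)" if "i \<in> {k..t}" for i
        unfolding word_with_runs_def NM(2)[rule_format, OF that] by (rule refl)
    qed
    then show "\<kappa> / 128 * t < card (shift_mismatches ?a d {s+1..t})" using k(1) large by linarith
  qed
qed

section \<open>Closeness of factors and the condition on \<rho>\<close>

lemma length_factor [simp]: "length (factor a i j) = nat (j - i + 1)"
  by (simp add: factor_def)

lemma nth_factor: "k < nat (j - i + 1) \<Longrightarrow> factor a i j ! k = a (nat (i + int k))"
  by (simp add: factor_def)

lemma factor_const:
  assumes "\<And>k. k \<in> {i..j} \<Longrightarrow> a (nat k) = z"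
  shows "factor a i j = replicate (nat (j - i + 1)) z"
  using assms by (intro nth_equalityI) (auto simp: nth_factor)

lemma close_words_refl: "\<lbrakk>\<epsilon> > 0; U \<noteq> []\<rbrakk> \<Longrightarrow> close_words \<epsilon> 0 U U"
  by (simp add: close_words_def mismatches_def)

text \<open>Position \<open>j\<close> of the two factors holds the letters of \<open>a\<close> at
  \<open>r + j\<close> and \<open>s + j\<close>, so subtracting \<open>s\<close> embeds the
  mismatches with the shift by \<open>s - r\<close> into the covered set.\<close>

lemma card_shift_mismatches_le:
  assumes close: "close_words \<epsilon> \<delta> (factor a (r + 1) (r + t - s)) (factor a (s + 1) t)"
    and rst: "-1 \<le> r" "r < s" "s < t"
  shows "card (shift_mismatches a (nat (s - r)) {nat s + 1..nat t}) \<le> \<epsilon> * real_of_int (t - s)"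
proof -
  let ?U = "factor a (r + 1) (r + t - s)" and ?V = "factor a (s + 1) t"
  let ?D = "shift_mismatches a (nat (s - r)) {nat s + 1..nat t}"
  obtain J :: "nat \<Rightarrow> nat set" where J:
    "\<And>j. j \<in> {1..\<delta>} \<Longrightarrow> subinterval (length ?U) (J j)"
    "mismatches ?U ?V \<subseteq> (\<Union>j\<in>{1..\<delta>}. J j)"
    "real (card (\<Union>j\<in>{1..\<delta>}. J j)) \<le> \<epsilon> * real (length ?U)"
    using close unfolding close_words_def by blast
  have "(\<lambda>i. i - nat s) ` ?D \<subseteq> mismatches ?U ?V"
  proof
    fix j assume "j \<in> (\<lambda>i. i - nat s) ` ?D"
    then obtain i where i: "j = i - nat s" "nat s < i" "i \<le> nat t" "a i \<noteq> a (i - nat (s - r))"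
      by (auto simp: shift_mismatches_def)
    \<comment> \<open>\<open>j - 1\<close> is the list index of position \<open>j\<close>, and
      \<open>r \<ge> -1\<close> keeps \<open>r + j\<close> nonnegative.\<close>
    have "nat (r + 1 + int (j - 1)) = i - nat (s - r)" "nat (s + 1 + int (j - 1)) = i"
      using i(1-3) rst by linarith+
    moreover have "j - 1 < nat (t - s)" "1 \<le> j" "j \<le> nat (t - s)"
      using i(1-3) rst by linarith+
    moreover have "j - 1 < nat (r + t - s - (r + 1) + 1)" "j - 1 < nat (t - (s + 1) + 1)"
      using i(1-3) rst by linarith+
    ultimately show "j \<in> mismatches ?U ?V"
      using i rst by (auto simp: mismatches_def nth_factor)
  qed
  moreover have "inj_on (\<lambda>i. i - nat s) ?D"
    by (auto simp: inj_on_def shift_mismatches_def)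
  moreover have "finite (\<Union>j\<in>{1..\<delta>}. J j)"
  proof (intro finite_UN_I)
    show "finite (J j)" if "j \<in> {1..\<delta>}" for j
      using J(1)[OF that] finite_subset[OF _ finite_atLeastAtMost] unfolding subinterval_def by blast
  qed simp
  ultimately have "card ?D \<le> card (\<Union>j\<in>{1..\<delta>}. J j)"
    using J(2) by (intro card_inj_on_le) auto
  then show ?thesis using J(3) rst by simp
qed

text \<open>The shift \<open>s n - r n\<close> tends to infinity and is at most
  \<open>s n + 1\<close>, so \<open>t n\<close> becomes large enough for
  \<open>word_with_runs_dissimilar\<close>. For the \<epsilon> from there, closeness allows only
  \<open>\<epsilon> * (t n - s n)\<close> mismatches, too few.\<close>

lemma cond_star_le:
  assumes w: "shift_dissimilar L0 w"
    and xyz: "distinct [x, y, z]" and \<rho>: "1 \<le> \<rho>"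
    and star: "cond_star \<rho>' (word_with_runs x y z w \<rho>)"
  shows "\<rho>' \<le> \<rho>"
proof (rule ccontr)
  assume "\<not> \<rho>' \<le> \<rho>"
  then have "\<rho> < \<rho>'" by simp
  let ?a = "word_with_runs x y z w \<rho>"
  obtain \<epsilon> :: real and T :: nat where \<epsilon>: "\<epsilon> > 0" and T:
    "\<forall>t\<ge>T. \<forall>s d :: nat. \<rho>' * s \<le> t \<longrightarrow> d \<in> {1..s+1} \<longrightarrow>
       \<epsilon> * real t < card (shift_mismatches ?a d {s+1..t})"
    using word_with_runs_dissimilar[OF w xyz \<rho> \<open>\<rho> < \<rho>'\<close>] by blast
  obtain r s t :: "nat \<Rightarrow> int" and \<delta> where
    rst: "\<And>n. -1 \<le> r n \<and> r n < s n \<and> s n < t n" and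
    st: "\<And>n. real_of_int (t n) \<ge> \<rho>' * real_of_int (s n)" and
    lim: "filterlim (\<lambda>n. s n - r n) at_top sequentially" and
    close: "\<forall>\<^sub>F n in sequentially.
       close_words \<epsilon> \<delta> (factor ?a (r n + 1) (r n + t n - s n)) (factor ?a (s n + 1) (t n))"
    using star[unfolded cond_star_def, rule_format, OF \<epsilon>] by (elim exE conjE) (rule that, simp_all)
  have "\<forall>\<^sub>F n in sequentially. int T + 1 \<le> s n - r n"
    using lim by (simp add: filterlim_at_top)
  with close have "\<forall>\<^sub>F n in sequentially. False"
  proof eventually_elim
    case (elim n)
    have R: "-1 \<le> r n" "r n < s n" "s n < t n" using rst by auto
    have "\<epsilon> * nat (t n) < card (shift_mismatches ?a (nat (s n - r n)) {nat (s n) + 1..nat (t n)})"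
      using R st[of n] elim(2) by (intro T[rule_format]) auto
    also have "\<dots> \<le> \<epsilon> * real_of_int (t n - s n)"
      using card_shift_mismatches_le[OF elim(1) R] .
    also have "\<dots> \<le> \<epsilon> * nat (t n)" using \<epsilon> R by (intro mult_left_mono) auto
    finally show False by simp
  qed
  then show False by simp
qed

text \<open>Both factors lie inside the \<open>n\<close>-th run, so they are the same constant word
  and \<open>\<delta> = 0\<close> suffices.\<close>

lemma cond_star_word_with_runs:
  assumes "\<rho> \<ge> 1"
  shows "cond_star \<rho> (word_with_runs x y z w \<rho>)"
  unfolding cond_star_def
proof (intro allI impI)
  fix \<epsilon> :: real assume "\<epsilon> > 0"
  let ?a = "word_with_runs x y z w \<rho>"
  \<comment> \<open>\<open>r n + 1\<close> and \<open>t n\<close> are the ends of the run, and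
    \<open>s n - r n = n + 1\<close>. The \<open>+ 1\<close> in \<open>run_end\<close> makes
    \<open>s n < t n\<close> strict even for \<open>\<rho> = 1\<close>.\<close>
  define r s t where "r n = int (run_start n) - 1" and "s n = int (run_start n + n)"
    and "t n = int (run_end \<rho> n)" for n
  have "\<rho> * (run_start n + n) \<ge> run_start n + n" for n
    using assms by (simp add: mult_le_cancel_right1)
  then have st: "s n < t n" "real_of_int (t n) \<ge> \<rho> * real_of_int (s n)" for n
    using run_end_bounds(1)[OF assms, of n] unfolding s_def t_def by (smt (verit) of_int_of_nat_eq of_nat_less_iff)+
  have a: "?a (nat k) = z" if "k \<in> {r n + 1..t n}" for k n
  proof -
    have "nat k \<in> {run_start n..run_end \<rho> n}" using that by (auto simp: r_def t_def)
    then show ?thesis unfolding word_with_runs_def by metis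
  qed
  have "close_words \<epsilon> 0 (factor ?a (r n + 1) (r n + t n - s n)) (factor ?a (s n + 1) (t n))" for n
  proof -
    have rs: "r n < s n" by (simp add: r_def s_def)
    have "factor ?a (r n + 1) (r n + t n - s n) = replicate (nat (t n - s n)) z"
      using rs a[of _ n] by (subst factor_const[of _ _ _ z]) auto
    moreover have "factor ?a (s n + 1) (t n) = replicate (nat (t n - s n)) z"
      using rs a[of _ n] by (subst factor_const[of _ _ _ z]) auto
    ultimately show ?thesis using \<open>\<epsilon> > 0\<close> st(1)[of n] by (simp add: close_words_refl)
  qed
  moreover have "filterlim (\<lambda>n. s n - r n) at_top sequentially"
    unfolding s_def r_def filterlim_at_top eventually_sequentially
    by (intro allI, rule_tac x = "nat Z" in exI) auto
  moreover have "-1 \<le> r n \<and> r n < s n \<and> s n < t n" for n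
    using st(1) by (auto simp: r_def s_def)
  ultimately show "\<exists>(r :: nat \<Rightarrow> int) s t \<delta>. (\<forall>n. -1 \<le> r n \<and> r n < s n \<and> s n < t n) \<and>
        (\<forall>n. real_of_int (t n) \<ge> \<rho> * real_of_int (s n)) \<and>
        filterlim (\<lambda>n. s n - r n) at_top sequentially \<and>
        (\<forall>\<^sub>F n in sequentially. close_words \<epsilon> \<delta>
          (factor ?a (r n + 1) (r n + t n - s n)) (factor ?a (s n + 1) (t n)))"
    using st(2) by (intro exI[of _ r] exI[of _ s] exI[of _ t] exI[of _ 0]) simp
qed

lemma cond_star_const: "cond_star \<rho> (\<lambda>_. z)"
  unfolding cond_star_def
proof (intro allI impI)
  fix \<epsilon> :: real assume "\<epsilon> > 0"
  \<comment> \<open>The maximum keeps \<open>s n = n\<close> below \<open>t n\<close> when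
    \<open>\<rho> * n \<le> n\<close>.\<close>
  define t where "t n = max (int n + 1) \<lceil>\<rho> * n\<rceil>" for n :: nat
  have "close_words \<epsilon> 0 (factor (\<lambda>_. z) (-1 + 1) (-1 + t n - int n)) (factor (\<lambda>_. z) (int n + 1) (t n))" for n
    using \<open>\<epsilon> > 0\<close> by (simp add: factor_const[of _ _ _ z] close_words_refl t_def)
  moreover have "filterlim (\<lambda>n. int n - (-1)) at_top sequentially"
    unfolding filterlim_at_top eventually_sequentially
    by (intro allI, rule_tac x = "nat Z" in exI) auto
  moreover have "real_of_int (t n) \<ge> \<rho> * real_of_int (int n)" for n
  proof -
    have "\<lceil>\<rho> * n\<rceil> \<le> t n" by (simp add: t_def)
    then show ?thesis by (simp add: ceiling_le_iff)
  qed
  ultimately show "\<exists>(r :: nat \<Rightarrow> int) s t \<delta>. (\<forall>n. -1 \<le> r n \<and> r n < s n \<and> s n < t n) \<and>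
        (\<forall>n. real_of_int (t n) \<ge> \<rho> * real_of_int (s n)) \<and>
        filterlim (\<lambda>n. s n - r n) at_top sequentially \<and>
        (\<forall>\<^sub>F n in sequentially. close_words \<epsilon> \<delta>
          (factor (\<lambda>_. z) (r n + 1) (r n + t n - s n)) (factor (\<lambda>_. z) (s n + 1) (t n)))"
    by (intro exI[of _ "\<lambda>_. -1"] exI[of _ int] exI[of _ t] exI[of _ 0]) (auto simp: t_def)
qed

text \<open>Factors of a single letter suffice here: some letter occurs infinitely often, and a
  fixed occurrence is compared with later and later ones.\<close>

lemma cond_star_1:
  assumes "finite (range a)"
  shows "cond_star 1 a"
  unfolding cond_star_def
proof (intro allI impI)
  fix \<epsilon> :: real assume "\<epsilon> > 0"
  obtain x where "infinite {i. a i = x}"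
    using pigeonhole_infinite[OF infinite_UNIV_nat assms] by auto
  from infinite_enumerate[OF this] obtain p :: "nat \<Rightarrow> nat"
    where p: "strict_mono p" "\<And>n. a (p n) = x"
    by auto
  \<comment> \<open>The \<open>- 1\<close> makes the two factors the single letters at
    \<open>p 0\<close> and \<open>p (Suc n)\<close>.\<close>
  define r s t where "r n = int (p 0) - 1" and "s n = int (p (Suc n)) - 1"
    and "t n = int (p (Suc n))" for n
  have single: "factor a i i = [a (nat i)]" for i by (simp add: factor_def)
  have "close_words \<epsilon> 0 (factor a (r n + 1) (r n + t n - s n)) (factor a (s n + 1) (t n))" for n
    using \<open>\<epsilon> > 0\<close> by (simp add: r_def s_def t_def single p close_words_refl)
  moreover have "-1 \<le> r n \<and> r n < s n \<and> s n < t n" for n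
    using p(1) by (auto simp: r_def s_def t_def strict_mono_def)
  moreover have "filterlim (\<lambda>n. s n - r n) at_top sequentially"
    unfolding filterlim_at_top eventually_sequentially
  proof (intro allI exI impI)
    fix Z n assume "nat (Z + int (p 0)) \<le> n"
    then show "Z \<le> s n - r n" 
      using seq_suble[OF p(1), of "Suc n"] by (simp add: s_def r_def)
  qed
  ultimately show "\<exists>(r :: nat \<Rightarrow> int) s t \<delta>. (\<forall>n. -1 \<le> r n \<and> r n < s n \<and> s n < t n) \<and>
        (\<forall>n. real_of_int (t n) \<ge> 1 * real_of_int (s n)) \<and>
        filterlim (\<lambda>n. s n - r n) at_top sequentially \<and>
        (\<forall>\<^sub>F n in sequentially. close_words \<epsilon> \<delta>
          (factor a (r n + 1) (r n + t n - s n)) (factor a (s n + 1) (t n)))"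
    by (intro exI[of _ r] exI[of _ s] exI[of _ t] exI[of _ 0]) (simp add: s_def t_def)
qed

section \<open>The set of values of the exponent\<close>

lemma Rdio_const: "Rdio (\<lambda>_. z) = \<infinity>"
proof -
  \<comment> \<open>The supremum ranges over \<rho> \<ge> 1 only, hence the maximum with 1.\<close>
  have "ereal (max 1 B) \<le> Rdio (\<lambda>_. z)" for B
    unfolding Rdio_def by (intro Sup_upper) (auto simp: cond_star_const intro!: exI[of _ "max 1 B"])
  then have "ereal B \<le> Rdio (\<lambda>_. z)" for B
    by (meson order_trans ereal_less_eq(3) max.cobounded2)
  then show ?thesis by (rule ereal_top)
qed

theorem theorem1p1:
  fixes A :: "'a set"
  assumes "card A = 3"
  shows "{Rdio a | a :: nat \<Rightarrow> 'a. range a \<subseteq> A} = {1..\<infinity>}"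
proof (intro equalityI subsetI)
  fix v assume "v \<in> {Rdio a | a :: nat \<Rightarrow> 'a. range a \<subseteq> A}"
  then obtain a :: "nat \<Rightarrow> 'a" where a: "v = Rdio a" "range a \<subseteq> A" by blast
  have "finite A" using assms by (intro card_ge_0_finite) simp
  then have "cond_star 1 a" using a(2) by (intro cond_star_1) (rule finite_subset)
  then have "ereal 1 \<le> Rdio a" unfolding Rdio_def by (intro Sup_upper) auto
  then show "v \<in> {1..\<infinity>}" using a by (simp add: one_ereal_def)
next
  fix v :: ereal assume v: "v \<in> {1..\<infinity>}"
  obtain x y z where A: "A = {x, y, z}" "distinct [x, y, z]"
    using assms by (auto simp: card_3_iff)
  show "v \<in> {Rdio a | a :: nat \<Rightarrow> 'a. range a \<subseteq> A}"
  proof (cases v)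
    case (real \<rho>)
    then have \<rho>: "\<rho> \<ge> 1" using v by simp
    obtain w :: "nat \<Rightarrow> bool" and L0 where w:
      "shift_dissimilar L0 w"
      using exists_shift_dissimilar by blast
    let ?a = "word_with_runs x y z w \<rho>"
    \<comment> \<open>The supremum is a maximum, attained at \<rho> itself.\<close>
    have "Rdio ?a = ereal \<rho>"
      unfolding Rdio_def
    proof (rule Sup_eqI)
      show "v \<le> ereal \<rho>" if "v \<in> {ereal \<rho>' |\<rho>'. 1 \<le> \<rho>' \<and> cond_star \<rho>' ?a}" for v
        using that cond_star_le[OF w A(2) \<rho>] by auto
      show "ereal \<rho> \<le> B" if "\<And>v. v \<in> {ereal \<rho>' |\<rho>'. 1 \<le> \<rho>' \<and> cond_star \<rho>' ?a} \<Longrightarrow> v \<le> B" for B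
        by (rule that, intro CollectI exI[of _ \<rho>] conjI refl \<rho> cond_star_word_with_runs)
    qed
    moreover have "range ?a \<subseteq> A" by (auto simp: word_with_runs_def A(1))
    ultimately show ?thesis using real by (intro CollectI exI[of _ ?a]) simp
  next
    case PInf
    have "range (\<lambda>_ :: nat. z) \<subseteq> A" by (simp add: A(1))
    then show ?thesis
      using PInf by (intro CollectI exI[of _ "\<lambda>_. z"]) (simp add: Rdio_const)
  qed (use v in simp)
qed

end
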